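(* Let $X$ be a stationary point process in $\mathbb{R}^d$, and let $W\subset\mathbb{R}^d$ be a compact set with nonempty interior. (i) Suppose $X$ is "ordered" in the sense that its $J$ functional is non-decreasing, that is, $K_1\subseteq K_2$ implies $\mathbb{J}(K_1)\le\mathbb{J}(K_2)$ (for compact sets $K_1,K_2$ containing the origin). Then $1\le J_W(r)\le J(r)$ for all $r\ge0$ (with $F(r)<1$). (ii) Suppose $X$ is "clustered" in the sense that $K_1\subseteq K_2$ implies $\mathbb{J}(K_1)\ge\mathbb{J}(K_2)$ (for compact sets $K_1,K_2$ containing the origin). Then $1\ge J_W(r)\ge J(r)$ for all $r\ge0$ (with $F(r)<1$).
   Context: Let $X$ be a stationary point process in $\mathbb{R}^d$ with intensity $\lambda\in(0,\infty)$, regarded as a random locally finite subset of $\mathbb{R}^d$ (i.e. a simple point process). Let $\mathbb{P}$ denote its distribution and $\mathbb{P}^{0!}$ its reduced Palm distribution at the origin $0$ (the distribution of $X\setminus\{0\}$ under the Palm distribution at $0$). $B(x,r)$ is the closed ball of radius $r$ centred at $x$. For every compact set $K\subset\mathbb{R}^d$ containing the origin define $$\mathbb{F}(K):=\mathbb{P}(X\cap K\neq\emptyset),\qquad \mathbb{G}(K):=\mathbb{P}^{0!}(X\cap K\neq\emptyset),\qquad \mathbb{J}(K):=\frac{1-\mathbb{G}(K)}{1-\mathbb{F}(K)},$$ where $\mathbb{J}(K)$ (the $J$ functional) is considered only for those $K$ with $\mathbb{F}(K)<1$. Put $F(r)=\mathbb{F}(B(0,r))$, $G(r)=\mathbb{G}(B(0,r))$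 and $J(r)=\frac{1-G(r)}{1-F(r)}=\mathbb{J}(B(0,r))$, defined for $F(r)<1$. For a compact set $W\subset\mathbb{R}^d$ with nonempty interior, the window based $J$ function is $$J_W(r):=\frac{\int_W[1-\mathbb{G}(B(0,r)\cap W_{-x})]\,dx}{\int_W[1-\mathbb{F}(B(0,r)\cap W_{-x})]\,dx},\qquad W_{-x}=\{y-x:y\in W\}.$$ *)

theory Defs
  imports "HOL-Probability.Probability"
begin

definition locally_finite_sets :: "'a::euclidean_space set set" where
  "locally_finite_sets = {\<phi>. \<forall>B. bounded B \<longrightarrow> finite (\<phi> \<inter> B)}"

text \<open>The usual sigma-algebra on point configurations: the smallest one making the point counts of
  all bounded Borel sets measurable. Such counts are finite, so the convention that \<^const>\<open>card\<close> is
  0 on infinite sets is never used.\<close>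

definition config_space :: "'a::euclidean_space set measure" where
  "config_space = sigma locally_finite_sets
     {{\<phi> \<in> locally_finite_sets. card (\<phi> \<inter> B) = n} | B n. B \<in> sets borel \<and> bounded B}"

definition translate :: "'a::euclidean_space \<Rightarrow> 'a set \<Rightarrow> 'a set" where
  "translate v A = (\<lambda>y. y + v) ` A"

definition point_process :: "'w measure \<Rightarrow> ('w \<Rightarrow> 'a::euclidean_space set) \<Rightarrow> bool" where
  "point_process M X \<longleftrightarrow> prob_space M \<and> X \<in> measurable M config_space"

definition distribution :: "'w measure \<Rightarrow> ('w \<Rightarrow> 'a::euclidean_space set) \<Rightarrow> 'a set measure" where
  "distribution M X = distr M config_space X"

definition stationary_point_process ::
    "'w measure \<Rightarrow> ('w \<Rightarrow> 'a::euclidean_space set) \<Rightarrow> bool" where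
  "stationary_point_process M X \<longleftrightarrow> point_process M X \<and>
     (\<forall>v. distribution M (\<lambda>\<omega>. translate v (X \<omega>)) = distribution M X)"

text \<open>In what follows \<open>P\<close> is the distribution of a stationary point process. The intensity and the
  Palm distribution at the origin are normalised with the unit cube; by stationarity any other
  Borel set \<open>B\<close> of positive finite volume, after division by that volume, gives the same.\<close>

abbreviation unit_cube :: "'a::euclidean_space set" where
  "unit_cube \<equiv> cbox 0 One"

definition intensity :: "'a::euclidean_space set measure \<Rightarrow> ennreal" where
  "intensity P = (\<integral>\<^sup>+\<phi>. of_nat (card (\<phi> \<inter> unit_cube)) \<partial>P)"

definition palm :: "'a::euclidean_space set measure \<Rightarrow> 'a set measure" where
  "palm P = measure_of (space config_space) (sets config_space)
     (\<lambda>A. (\<integral>\<^sup>+\<phi>. (\<Sum>x\<in>\<phi> \<inter> unit_cube. indicator A (translate (- x) \<phi>)) \<partial>P) / intensity P)"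

definition reduced_palm :: "'a::euclidean_space set measure \<Rightarrow> 'a set measure" where
  "reduced_palm P = distr (palm P) config_space (\<lambda>\<phi>. \<phi> - {0})"

definition hitting_prob :: "'a::euclidean_space set measure \<Rightarrow> 'a set \<Rightarrow> real" where
  "hitting_prob Q K = measure Q {\<phi> \<in> space Q. \<phi> \<inter> K \<noteq> {}}"

definition FF :: "'a::euclidean_space set measure \<Rightarrow> 'a set \<Rightarrow> real" where
  "FF P K = hitting_prob P K"

definition GG :: "'a::euclidean_space set measure \<Rightarrow> 'a set \<Rightarrow> real" where
  "GG P K = hitting_prob (reduced_palm P) K"

definition JJ :: "'a::euclidean_space set measure \<Rightarrow> 'a set \<Rightarrow> real" where
  "JJ P K = (1 - GG P K) / (1 - FF P K)"

definition J_domain :: "'a::euclidean_space set measure \<Rightarrow> 'a set set" where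
  "J_domain P = {K. compact K \<and> 0 \<in> K \<and> FF P K < 1}"

definition F_fun :: "'a::euclidean_space set measure \<Rightarrow> real \<Rightarrow> real" where
  "F_fun P r = FF P (cball 0 r)"

definition G_fun :: "'a::euclidean_space set measure \<Rightarrow> real \<Rightarrow> real" where
  "G_fun P r = GG P (cball 0 r)"

definition J_fun :: "'a::euclidean_space set measure \<Rightarrow> real \<Rightarrow> real" where
  "J_fun P r = (1 - G_fun P r) / (1 - F_fun P r)"

definition J_window :: "'a::euclidean_space set measure \<Rightarrow> 'a set \<Rightarrow> real \<Rightarrow> real" where
  "J_window P W r =
     (LINT x:W|lborel. 1 - GG P (cball 0 r \<inter> translate (- x) W)) /
     (LINT x:W|lborel. 1 - FF P (cball 0 r \<inter> translate (- x) W))"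

definition J_ordered :: "'a::euclidean_space set measure \<Rightarrow> bool" where
  "J_ordered P \<longleftrightarrow>
     (\<forall>K1\<in>J_domain P. \<forall>K2\<in>J_domain P. K1 \<subseteq> K2 \<longrightarrow> JJ P K1 \<le> JJ P K2)"

definition J_clustered :: "'a::euclidean_space set measure \<Rightarrow> bool" where
  "J_clustered P \<longleftrightarrow>
     (\<forall>K1\<in>J_domain P. \<forall>K2\<in>J_domain P. K1 \<subseteq> K2 \<longrightarrow> JJ P K1 \<ge> JJ P K2)"

end

theory Submission
  imports Defs
begin

text \<open>
  For \<open>x \<in> W\<close> put \<open>K x = cball 0 r \<inter> translate (- x) W\<close>. This is a compact set with
  \<open>{0} \<subseteq> K x \<subseteq> cball 0 r\<close>, so monotonicity of the functional \<open>JJ\<close> traps \<open>JJ P (K x)\<close> between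
  \<open>JJ P {0}\<close> and \<open>JJ P (cball 0 r) = J_fun P r\<close>. The first of these is 1: a stationary process of
  finite intensity has no point at a prescribed location almost surely
  (\<open>hitting_prob_origin_stationary\<close>), and the reduced Palm distribution has discarded the point at
  the origin (\<open>hitting_prob_origin_reduced_palm\<close>). Multiplying by \<open>1 - FF P (K x) > 0\<close> and
  integrating over \<open>W\<close> carries the two bounds from \<open>JJ P (K x)\<close> to \<open>J_window P W r\<close>, which is an
  average of the values \<open>JJ P (K x)\<close> with weights \<open>1 - FF P (K x)\<close>. The ordered and the clustered
  case differ only in which bound is the lower one; \<open>J_window_bounds\<close> covers both.

  The analytic content is that both integrands are integrable. The events ``the configuration meets
  \<open>K x\<close>'' depend upper semicontinuously on \<open>x\<close>, since \<open>W\<close> is closed and only finitely many points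
  of a configuration lie in a ball. Hence the hitting probabilities are upper semicontinuous in \<open>x\<close>
  for every finite measure on configurations (\<open>closed_translate_hitting_levels\<close>), in particular for
  \<open>P\<close> and for the reduced Palm distribution.
\<close>

section \<open>Measurability on the space of configurations\<close>

lemma space_config_space: "space config_space = (locally_finite_sets :: 'a::euclidean_space set set)"
  unfolding config_space_def by (rule space_measure_of) auto

lemma config_count_sets:
  fixes B :: "'a::euclidean_space set"
  assumes "B \<in> sets borel" "bounded B"
  shows "{\<phi> \<in> locally_finite_sets. card (\<phi> \<inter> B) = n} \<in> sets config_space"
  unfolding config_space_def using assms by (subst sets_measure_of) auto

text \<open>Boundedness makes \<open>\<phi> \<inter> K\<close> finite, so that cardinality 0 does mean emptiness.\<close>

lemma hitting_event_eq:
  fixes K :: "'a::euclidean_space set"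
  assumes "bounded K"
  shows "{\<phi> \<in> locally_finite_sets. \<phi> \<inter> K \<noteq> {}}
       = locally_finite_sets - {\<phi> \<in> locally_finite_sets. card (\<phi> \<inter> K) = 0}"
  using assms by (auto simp: locally_finite_sets_def)

lemma hitting_event_sets:
  fixes K :: "'a::euclidean_space set"
  assumes "compact K"
  shows "{\<phi> \<in> locally_finite_sets. \<phi> \<inter> K \<noteq> {}} \<in> sets config_space"
proof -
  have "K \<in> sets borel" "bounded K"
    using assms by (auto simp: borel_compact compact_imp_bounded)
  moreover have "(locally_finite_sets :: 'a set set) \<in> sets config_space"
    using sets.top[of "config_space :: 'a set measure"] by (simp add: space_config_space)
  ultimately show ?thesis
    by (simp add: hitting_event_eq config_count_sets sets.Diff)
qed

lemma measurable_into_config_space: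
  fixes f :: "'b \<Rightarrow> 'a::euclidean_space set"
  assumes "\<And>\<omega>. \<omega> \<in> space N \<Longrightarrow> f \<omega> \<in> locally_finite_sets"
    and "\<And>B n. B \<in> sets borel \<Longrightarrow> bounded B \<Longrightarrow> {\<omega> \<in> space N. card (f \<omega> \<inter> B) = n} \<in> sets N"
  shows "f \<in> measurable N config_space"
  unfolding config_space_def
proof (rule measurable_measure_of)
  fix A :: "'a set set"
  assume "A \<in> {{\<phi> \<in> locally_finite_sets. card (\<phi> \<inter> B) = n} | B n. B \<in> sets borel \<and> bounded B}"
  then obtain B n where B: "B \<in> sets borel" "bounded B"
      "A = {\<phi> \<in> locally_finite_sets. card (\<phi> \<inter> B) = n}" by auto
  then have "f -` A \<inter> space N = {\<omega> \<in> space N. card (f \<omega> \<inter> B) = n}"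
    using assms(1) by auto
  then show "f -` A \<inter> space N \<in> sets N" using assms(2) B by simp
qed (use assms(1) in auto)

text \<open>Removing a point from the configuration has the same effect on a count as removing it from the
  counting region.\<close>

lemma remove_point_measurable:
  "(\<lambda>\<phi>. \<phi> - {a}) \<in> measurable config_space (config_space :: 'a::euclidean_space set measure)"
proof (rule measurable_into_config_space)
  fix B :: "'a set" and n
  assume "B \<in> sets borel" "bounded B"
  then have "B - {a} \<in> sets borel" "bounded (B - {a})" by (auto intro: bounded_subset)
  from config_count_sets[OF this, of n]
  have "{\<phi> \<in> locally_finite_sets. card (\<phi> \<inter> (B - {a})) = n} \<in> sets config_space" .
  moreover have "(\<phi> - {a}) \<inter> B = \<phi> \<inter> (B - {a})" for \<phi> by auto
  ultimately
  show "{\<phi> \<in> space config_space. card ((\<phi> - {a}) \<inter> B) = n} \<in> sets config_space"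
    by (simp add: space_config_space)
qed (auto simp: space_config_space locally_finite_sets_def intro: finite_subset)

text \<open>Translating the configuration has the same effect on a count as translating the counting region
  in the opposite direction.\<close>

lemma translate_measurable:
  "translate v \<in> measurable config_space (config_space :: 'a::euclidean_space set measure)"
proof (rule measurable_into_config_space)
  have fin: "finite (translate v \<phi> \<inter> B)"
    if "\<phi> \<in> locally_finite_sets" "bounded B" for \<phi> B :: "'a set"
  proof -
    have "translate v \<phi> \<inter> B = (\<lambda>y. y + v) ` (\<phi> \<inter> (\<lambda>y. y - v) ` B)"
      by (force simp: translate_def)
    moreover have "finite (\<phi> \<inter> (\<lambda>y. y - v) ` B)"
      using that by (auto simp: locally_finite_sets_def bounded_translation_minus)
    ultimately show ?thesis by simp
  qed
  then show "translate v \<phi> \<in> locally_finite_sets"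
    if "\<phi> \<in> space config_space" for \<phi> :: "'a set"
    using that by (auto simp: space_config_space locally_finite_sets_def)
  fix B :: "'a set" and n
  assume B: "B \<in> sets borel" "bounded B"
  have im: "(\<lambda>y. y - v) ` B = (\<lambda>y. y + v) -` B \<inter> space borel" by force
  have "(\<lambda>y. y - v) ` B \<in> sets borel"
    unfolding im using B(1) by (intro measurable_sets[where A = borel]) auto
  moreover have "bounded ((\<lambda>y. y - v) ` B)" using B(2) by (rule bounded_translation_minus)
  ultimately have "{\<phi> \<in> locally_finite_sets. card (\<phi> \<inter> (\<lambda>y. y - v) ` B) = n} \<in> sets config_space"
    by (rule config_count_sets)
  moreover have "card (translate v \<phi> \<inter> B) = card (\<phi> \<inter> (\<lambda>y. y - v) ` B)" for \<phi>
  proof -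
    have "translate v \<phi> \<inter> B = (\<lambda>y. y + v) ` (\<phi> \<inter> (\<lambda>y. y - v) ` B)"
      by (force simp: translate_def)
    then show ?thesis by (simp add: card_image inj_on_def)
  qed
  ultimately show "{\<phi> \<in> space config_space. card (translate v \<phi> \<inter> B) = n} \<in> sets config_space"
    by (simp add: space_config_space)
qed

section \<open>Prescribed locations are almost surely unoccupied\<close>

lemma prob_point_translation_invariant:
  assumes "stationary_point_process M X" and "P = distribution M X"
  shows "emeasure P {\<phi> \<in> locally_finite_sets. \<phi> \<inter> {v} \<noteq> {}}
       = emeasure P {\<phi> \<in> locally_finite_sets. \<phi> \<inter> {0} \<noteq> {}}"
proof -
  have X: "X \<in> measurable M config_space"
    and st: "distr M config_space (\<lambda>\<omega>. translate (- v) (X \<omega>)) = P"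
    using assms by (auto simp: stationary_point_process_def point_process_def distribution_def)
  have tX: "(\<lambda>\<omega>. translate (- v) (X \<omega>)) \<in> measurable M config_space"
    using measurable_compose[OF X translate_measurable] .
  have loc: "X \<omega> \<in> locally_finite_sets" "translate (- v) (X \<omega>) \<in> locally_finite_sets"
    if "\<omega> \<in> space M" for \<omega>
    using measurable_space[OF X that] measurable_space[OF tX that] by (auto simp: space_config_space)
  have "0 \<in> translate (- v) A \<longleftrightarrow> v \<in> A" for A
    by (force simp: translate_def)
  then have eq: "X -` {\<phi> \<in> locally_finite_sets. \<phi> \<inter> {v} \<noteq> {}} \<inter> space M
    = (\<lambda>\<omega>. translate (- v) (X \<omega>)) -` {\<phi> \<in> locally_finite_sets. \<phi> \<inter> {0} \<noteq> {}} \<inter> space M"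
    using loc by auto
  have "emeasure P {\<phi> \<in> locally_finite_sets. \<phi> \<inter> {v} \<noteq> {}}
      = emeasure M (X -` {\<phi> \<in> locally_finite_sets. \<phi> \<inter> {v} \<noteq> {}} \<inter> space M)"
    unfolding assms(2) distribution_def
    by (rule emeasure_distr[OF X]) (rule hitting_event_sets, simp)
  also have "\<dots> = emeasure P {\<phi> \<in> locally_finite_sets. \<phi> \<inter> {0} \<noteq> {}}"
    unfolding eq st[symmetric]
    by (rule emeasure_distr[OF tX, symmetric]) (rule hitting_event_sets, simp)
  finally show ?thesis .
qed

text \<open>Every location is occupied with the same probability \<open>p\<close>. Any \<open>n\<close> locations in the unit cube
  contribute \<open>n * p\<close> to the expected number of points there, so a positive \<open>p\<close> would make the
  intensity infinite.\<close>

lemma hitting_prob_origin_stationary: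
  fixes X :: "'w \<Rightarrow> 'a::euclidean_space set"
  assumes st: "stationary_point_process M X" and P: "P = distribution M X"
    and fin: "intensity P < \<infinity>"
  shows "hitting_prob P {0} = 0"
proof -
  define H where "H v = {\<phi> \<in> locally_finite_sets. \<phi> \<inter> {v} \<noteq> {}}" for v :: 'a
  have setsP: "sets P = sets config_space" and spP: "space P = locally_finite_sets"
    by (simp_all add: P distribution_def space_config_space)
  have H: "H v \<in> sets P" for v
    unfolding H_def setsP by (intro hitting_event_sets) simp
  have bound: "of_nat n * emeasure P (H 0) \<le> intensity P" for n
  proof -
    have "infinite (unit_cube :: 'a set)"
      using interior_cbox[of "0::'a" One] empty_interior_finite[of "unit_cube :: 'a set"]
      by (auto simp: box_eq_empty)
    then obtain S :: "'a set" where S: "S \<subseteq> unit_cube" "finite S" "card S = n"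
      using infinite_arbitrarily_large by metis
    have "(\<Sum>v\<in>S. emeasure P (H v)) = (\<Sum>v\<in>S. emeasure P (H 0))"
      unfolding H_def by (intro sum.cong refl prob_point_translation_invariant[OF st P])
    then have "of_nat n * emeasure P (H 0) = (\<Sum>v\<in>S. emeasure P (H v))"
      using S by simp
    also have "\<dots> = (\<Sum>v\<in>S. \<integral>\<^sup>+\<phi>. indicator (H v) \<phi> \<partial>P)"
      using H by simp
    also have "\<dots> = (\<integral>\<^sup>+\<phi>. (\<Sum>v\<in>S. indicator (H v) \<phi>) \<partial>P)"
      using H by (intro nn_integral_sum[symmetric] borel_measurable_indicator)
    also have "\<dots> \<le> intensity P"
      unfolding intensity_def
    proof (rule nn_integral_mono)
      fix \<phi> assume "\<phi> \<in> space P"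
      then have \<phi>: "\<phi> \<in> locally_finite_sets" by (simp add: spP)
      have "(\<Sum>v\<in>S. indicator (H v) \<phi> :: ennreal) = (\<Sum>v\<in>S. indicator \<phi> v)"
        using \<phi> by (intro sum.cong) (auto simp: H_def indicator_def)
      also have "\<dots> = of_nat (card (S \<inter> \<phi>))"
        using S(2) by (simp add: indicator_def sum.If_cases)
      also have "card (S \<inter> \<phi>) \<le> card (\<phi> \<inter> unit_cube)"
        using \<phi> S(1) by (intro card_mono) (auto simp: locally_finite_sets_def)
      finally show "(\<Sum>v\<in>S. indicator (H v) \<phi>) \<le> (of_nat (card (\<phi> \<inter> unit_cube)) :: ennreal)"
        by simp
    qed
    finally show ?thesis .
  qed
  have "emeasure P (H 0) = 0"
  proof (rule ccontr)
    assume "emeasure P (H 0) \<noteq> 0"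
    then have "(SUP n. of_nat n) * emeasure P (H 0) = \<infinity>"
      by (simp add: ennreal_SUP_of_nat_eq_top ennreal_top_mult)
    moreover have "(SUP n. of_nat n) * emeasure P (H 0) \<le> intensity P"
      unfolding SUP_mult_right_ennreal by (rule SUP_least) (rule bound)
    ultimately show False using fin by (simp add: top_unique)
  qed
  then show ?thesis unfolding hitting_prob_def spP measure_def H_def by simp
qed

section \<open>The Palm measure has finite mass\<close>

lemma sets_palm [simp]: "sets (palm P) = sets config_space"
  and space_palm [simp]: "space (palm P) = space config_space"
  by (simp_all add: palm_def)

lemma remove_point_measurable_palm:
  "(\<lambda>\<phi>. \<phi> - {0}) \<in> measurable (palm P) (config_space :: 'a::euclidean_space set measure)"
  unfolding measurable_cong_sets[OF sets_palm refl] by (rule remove_point_measurable)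

text \<open>Either \<open>\<mu>\<close> is a measure, with equality on the generated sigma-algebra, or the left-hand side is
  0 by the convention of \<open>measure_of\<close>. An upper bound for the Palm measure can therefore be read off
  from its defining formula.\<close>

lemma emeasure_measure_of_le: "emeasure (measure_of \<Omega> A \<mu>) B \<le> \<mu> B"
  by (simp add: emeasure_measure_of_conv)

text \<open>Each point of the unit cube contributes at most 1 to the sum that defines the Palm measure, so
  the numerator is at most the expected number of points in the cube.\<close>

lemma palm_total_mass_le:
  fixes P :: "'a::euclidean_space set measure"
  shows "emeasure (palm P) A \<le> intensity P / intensity P"
proof -
  have "emeasure (palm P) A
      \<le> (\<integral>\<^sup>+\<phi>. (\<Sum>x\<in>\<phi> \<inter> unit_cube. indicator A (translate (- x) \<phi>)) \<partial>P) / intensity P"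
    unfolding palm_def by (rule emeasure_measure_of_le)
  also have "\<dots> \<le> intensity P / intensity P"
  proof (rule divide_right_mono_ennreal)
    show "(\<integral>\<^sup>+\<phi>. (\<Sum>x\<in>\<phi> \<inter> unit_cube. indicator A (translate (- x) \<phi>)) \<partial>P) \<le> intensity P"
      unfolding intensity_def
    proof (rule nn_integral_mono)
      fix \<phi> :: "'a set"
      have "(\<Sum>x\<in>\<phi> \<inter> unit_cube. indicator A (translate (- x) \<phi>) :: ennreal)
          \<le> (\<Sum>x\<in>\<phi> \<inter> unit_cube. 1)"
        by (intro sum_mono) (simp add: indicator_def)
      then show "(\<Sum>x\<in>\<phi> \<inter> unit_cube. indicator A (translate (- x) \<phi>))
          \<le> (of_nat (card (\<phi> \<inter> unit_cube)) :: ennreal)" by simp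
    qed
  qed
  finally show ?thesis .
qed

lemma palm_finite_measure:
  assumes "0 < intensity P" and "intensity P < \<infinity>"
  shows "finite_measure (palm P)"
proof (rule finite_measureI)
  have "intensity P / intensity P = 1"
    using assms by (intro ennreal_divide_self) auto
  then show "emeasure (palm P) (space (palm P)) \<noteq> \<infinity>"
    using palm_total_mass_le[of P "space (palm P)"] by (auto simp: top_unique)
qed

lemma reduced_palm_finite_measure:
  assumes "0 < intensity P" and "intensity P < \<infinity>"
  shows "finite_measure (reduced_palm P)"
  unfolding reduced_palm_def
  by (intro finite_measure.finite_measure_distr palm_finite_measure assms remove_point_measurable_palm)

lemma hitting_prob_origin_reduced_palm:
  "hitting_prob (reduced_palm P) {0 :: 'a::euclidean_space} = 0"
proof -
  let ?H = "{\<phi> \<in> locally_finite_sets. \<phi> \<inter> {0} \<noteq> {}} :: 'a::euclidean_space set set"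
  have "measure (distr (palm P) config_space (\<lambda>\<phi>. \<phi> - {0})) ?H
      = measure (palm P) ((\<lambda>\<phi>. \<phi> - {0}) -` ?H \<inter> space (palm P))"
    by (intro measure_distr remove_point_measurable_palm hitting_event_sets) simp
  also have "(\<lambda>\<phi>. \<phi> - {0}) -` ?H = {}" by auto
  finally show ?thesis
    by (simp add: hitting_prob_def reduced_palm_def space_config_space)
qed

section \<open>Semicontinuity of hitting probabilities in the window position\<close>

text \<open>Suppose \<open>s n\<close> converges to \<open>l\<close> and a configuration meets \<open>C \<inter> translate (- s n) W\<close> for
  infinitely many \<open>n\<close>. As it has finitely many points in \<open>C\<close>, one fixed point \<open>y\<close> is responsible
  infinitely often; then \<open>y + s n \<in> W\<close> infinitely often and \<open>y + l \<in> W\<close> because \<open>W\<close> is closed.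
  The limit superior of the hitting events is thus contained in the hitting event at \<open>l\<close>, and
  continuity from above of the finite measure \<open>Q\<close> preserves the bound \<open>c\<close>.\<close>

lemma closed_translate_hitting_levels:
  fixes C W :: "'a::euclidean_space set"
  assumes Q: "finite_measure Q" "sets Q = sets config_space"
    and C: "compact C" and W: "closed W"
  shows "closed {x. c \<le> hitting_prob Q (C \<inter> translate (- x) W)}"
proof (unfold closed_sequential_limits, intro allI impI, elim conjE)
  interpret finite_measure Q by fact
  fix s l assume s: "\<forall>n. s n \<in> {x. c \<le> hitting_prob Q (C \<inter> translate (- x) W)}"
    and lim: "s \<longlonglongrightarrow> l"
  define A where "A x = {\<phi> \<in> locally_finite_sets. \<phi> \<inter> (C \<inter> translate (- x) W) \<noteq> {}}" for x
  have spQ: "space Q = locally_finite_sets"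
    using sets_eq_imp_space_eq[OF Q(2)] by (simp add: space_config_space)
  have tr: "translate (- x) W = (\<lambda>y. y - x) ` W" for x by (simp add: translate_def)
  have cl: "closed (translate (- x) W)" for x
    unfolding tr using W by (rule closed_translation_subtract)
  have A: "A x \<in> sets Q" for x
    unfolding A_def Q(2) by (intro hitting_event_sets compact_Int_closed C cl)
  have hit: "hitting_prob Q (C \<inter> translate (- x) W) = measure Q (A x)" for x
    by (simp add: hitting_prob_def A_def spQ)
  have limsup: "(\<Inter>m. \<Union>n\<in>{m..}. A (s n)) \<subseteq> A l"
  proof
    fix \<phi> assume \<phi>: "\<phi> \<in> (\<Inter>m. \<Union>n\<in>{m..}. A (s n))"
    then have lf: "\<phi> \<in> locally_finite_sets" by (auto simp: A_def)
    have "finite (\<phi> \<inter> C)"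
      using lf C by (auto simp: locally_finite_sets_def compact_imp_bounded)
    moreover have "\<exists>\<^sub>F n in sequentially. \<exists>y\<in>\<phi> \<inter> C. y + s n \<in> W"
      unfolding frequently_sequentially
    proof
      fix m
      from \<phi> obtain n where "n \<ge> m" "\<phi> \<in> A (s n)" by auto
      then show "\<exists>n\<ge>m. \<exists>y\<in>\<phi> \<inter> C. y + s n \<in> W" by (force simp: A_def tr)
    qed
    ultimately have "\<exists>y\<in>\<phi> \<inter> C. \<exists>\<^sub>F n in sequentially. y + s n \<in> W"
      by (rule frequently_bex_finite)
    then obtain y where y: "y \<in> \<phi> \<inter> C" "\<exists>\<^sub>F n in sequentially. y + s n \<in> W" ..
    have "y + l \<in> W"
    proof (rule ccontr)
      assume "y + l \<notin> W"
      moreover have "(\<lambda>n. y + s n) \<longlonglongrightarrow> y + l" by (intro tendsto_intros lim)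
      ultimately have "\<forall>\<^sub>F n in sequentially. y + s n \<in> - W"
        using W by (intro topological_tendstoD) auto
      with y(2) show False by (simp add: frequently_def)
    qed
    then have "y \<in> translate (- l) W" unfolding tr by force
    then show "\<phi> \<in> A l" using y(1) lf by (auto simp: A_def)
  qed
  have "(\<lambda>m. measure Q (\<Union>n\<in>{m..}. A (s n))) \<longlonglongrightarrow> measure Q (\<Inter>m. \<Union>n\<in>{m..}. A (s n))"
    using A by (intro finite_Lim_measure_decseq) (force simp: decseq_def)+
  moreover have "c \<le> measure Q (\<Union>n\<in>{m..}. A (s n))" for m
  proof -
    have "c \<le> measure Q (A (s m))" using s hit by auto
    also have "\<dots> \<le> measure Q (\<Union>n\<in>{m..}. A (s n))"
      using A by (intro finite_measure_mono) auto
    finally show ?thesis .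
  qed
  ultimately have "c \<le> measure Q (\<Inter>m. \<Union>n\<in>{m..}. A (s n))"
    by (intro LIMSEQ_le_const) auto
  also have "\<dots> \<le> measure Q (A l)" using A limsup by (intro finite_measure_mono)
  finally show "l \<in> {x. c \<le> hitting_prob Q (C \<inter> translate (- x) W)}" by (simp add: hit)
qed

lemma hitting_prob_window_integrable:
  fixes C W :: "'a::euclidean_space set"
  assumes Q: "finite_measure Q" "sets Q = sets config_space"
    and C: "compact C" and W: "compact W"
  shows "set_integrable lborel W (\<lambda>x. 1 - hitting_prob Q (C \<inter> translate (- x) W))"
proof -
  interpret finite_measure Q by fact
  have [measurable]: "(\<lambda>x. hitting_prob Q (C \<inter> translate (- x) W)) \<in> borel_measurable borel"
    unfolding borel_measurable_iff_ge
    using closed_translate_hitting_levels[OF Q C compact_imp_closed[OF W]]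
    by (auto intro: borel_closed)
  have "W \<in> sets lborel" using W by (simp add: borel_compact)
  moreover have "emeasure lborel W < \<infinity>" using W by (rule emeasure_compact_finite)
  moreover have "norm (1 - hitting_prob Q K) \<le> 1 + measure Q (space Q)" for K
    using bounded_measure[of "{\<phi> \<in> space Q. \<phi> \<inter> K \<noteq> {}}"]
      measure_nonneg[of Q "{\<phi> \<in> space Q. \<phi> \<inter> K \<noteq> {}}"]
    unfolding hitting_prob_def real_norm_def by linarith
  ultimately show ?thesis
    unfolding set_integrable_def
    by (intro integrableI_bounded_set_indicator[where B = "1 + measure Q (space Q)"]) auto
qed

section \<open>From the J functional to the window based J function\<close>

lemma set_integral_quotient_bounds:
  fixes f g :: "'b \<Rightarrow> real"
  assumes f: "set_integrable N W f" and g: "set_integrable N W g"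
    and pos: "0 < (LINT x:W|N. f x)"
    and "\<And>x. x \<in> W \<Longrightarrow> l * f x \<le> g x" and "\<And>x. x \<in> W \<Longrightarrow> g x \<le> u * f x"
  shows "l \<le> (LINT x:W|N. g x) / (LINT x:W|N. f x)" "(LINT x:W|N. g x) / (LINT x:W|N. f x) \<le> u"
proof -
  have "(LINT x:W|N. l * f x) \<le> (LINT x:W|N. g x)" "(LINT x:W|N. g x) \<le> (LINT x:W|N. u * f x)"
    using f g assms(4,5) by (auto intro!: set_integral_mono simp del: set_integral_mult_right)
  then show "l \<le> (LINT x:W|N. g x) / (LINT x:W|N. f x)" "(LINT x:W|N. g x) / (LINT x:W|N. f x) \<le> u"
    using pos by (auto simp: field_simps)
qed

lemma hitting_prob_mono:
  fixes K L :: "'a::euclidean_space set"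
  assumes Q: "finite_measure Q" "sets Q = sets config_space" and L: "compact L" and sub: "K \<subseteq> L"
  shows "hitting_prob Q K \<le> hitting_prob Q L"
proof -
  interpret finite_measure Q by fact
  have spQ: "space Q = locally_finite_sets"
    using sets_eq_imp_space_eq[OF Q(2)] by (simp add: space_config_space)
  show ?thesis
    unfolding hitting_prob_def spQ
    using hitting_event_sets[OF L] sub Q(2) by (intro finite_measure_mono) auto
qed

text \<open>The integrand is at least \<open>1 - F_fun P r > 0\<close> by monotonicity, and \<open>W\<close> contains a ball.\<close>

lemma window_integral_empty_prob_pos:
  fixes W :: "'a::euclidean_space set"
  assumes P: "finite_measure P" "sets P = sets config_space"
    and W: "compact W" "interior W \<noteq> {}" and F: "F_fun P r < 1"
  shows "0 < (LINT x:W|lborel. 1 - FF P (cball 0 r \<inter> translate (- x) W))"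
proof -
  have Wb: "W \<in> sets lborel" and Wfin: "emeasure lborel W < \<infinity>"
    using W emeasure_compact_finite by (auto simp: borel_compact)
  obtain a e where "e > 0" and ball: "ball a e \<subseteq> W"
    using W(2) by (meson all_not_in_conv mem_interior)
  then have "0 < measure lborel (ball a e)" by (intro content_ball_pos)
  also have "\<dots> \<le> measure lborel W"
    using ball Wb Wfin by (intro measure_mono_fmeasurable fmeasurableI) auto
  finally have "0 < measure lborel W * (1 - F_fun P r)" using F by simp
  also have "\<dots> = (LINT x:W|lborel. 1 - F_fun P r)"
    using Wb Wfin by (simp add: set_lebesgue_integral_def)
  also have "\<dots> \<le> (LINT x:W|lborel. 1 - FF P (cball 0 r \<inter> translate (- x) W))"
  proof (rule set_integral_mono)
    show "set_integrable lborel W (\<lambda>x. 1 - F_fun P r)"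
      using Wb Wfin unfolding set_integrable_def by simp
    show "set_integrable lborel W (\<lambda>x. 1 - FF P (cball 0 r \<inter> translate (- x) W))"
      unfolding FF_def using P W by (intro hitting_prob_window_integrable) auto
    show "1 - F_fun P r \<le> 1 - FF P (cball 0 r \<inter> translate (- x) W)" for x
      unfolding F_fun_def FF_def using hitting_prob_mono[OF P, of "cball 0 r"] by simp
  qed
  finally show ?thesis .
qed

text \<open>The set \<open>K x\<close> is an admissible argument of \<open>JJ\<close>: it contains 0 because \<open>x \<in> W\<close>, and it is hit
  with probability below 1 because \<open>cball 0 r\<close> is.\<close>

lemma J_window_bounds:
  fixes W :: "'a::euclidean_space set"
  assumes P: "finite_measure P" "sets P = sets config_space"
    and int: "0 < intensity P" "intensity P < \<infinity>"
    and W: "compact W" "interior W \<noteq> {}" and r: "0 \<le> r" and F: "F_fun P r < 1"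
    and lu: "\<And>K. K \<in> J_domain P \<Longrightarrow> K \<subseteq> cball 0 r \<Longrightarrow> l \<le> JJ P K \<and> JJ P K \<le> u"
  shows "l \<le> J_window P W r \<and> J_window P W r \<le> u"
proof -
  have Q: "finite_measure (reduced_palm P)" "sets (reduced_palm P) = sets config_space"
    using reduced_palm_finite_measure[OF int] by (simp_all add: reduced_palm_def)
  define K where "K x = cball 0 r \<inter> translate (- x) W" for x
  have bnd: "l * (1 - FF P (K x)) \<le> 1 - GG P (K x)" "1 - GG P (K x) \<le> u * (1 - FF P (K x))"
    if x: "x \<in> W" for x
  proof -
    have "FF P (K x) \<le> F_fun P r"
      unfolding F_fun_def FF_def K_def by (rule hitting_prob_mono[OF P]) auto
    then have FK: "FF P (K x) < 1" using F by simp
    have "translate (- x) W = (\<lambda>y. y - x) ` W" by (simp add: translate_def)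
    then have "closed (translate (- x) W)"
      using closed_translation_subtract[OF compact_imp_closed[OF W(1)]] by simp
    moreover have "0 \<in> translate (- x) W" using x by (force simp: translate_def)
    ultimately have "K x \<in> J_domain P"
      using FK r by (auto simp: J_domain_def K_def)
    then have "l \<le> JJ P (K x)" "JJ P (K x) \<le> u" using lu[of "K x"] by (auto simp: K_def)
    then show "l * (1 - FF P (K x)) \<le> 1 - GG P (K x)" "1 - GG P (K x) \<le> u * (1 - FF P (K x))"
      using FK by (simp_all add: JJ_def field_simps)
  qed
  have "set_integrable lborel W (\<lambda>x. 1 - FF P (K x))" "set_integrable lborel W (\<lambda>x. 1 - GG P (K x))"
    unfolding FF_def GG_def K_def using P Q W
    by (auto intro!: hitting_prob_window_integrable)
  moreover have "0 < (LINT x:W|lborel. 1 - FF P (K x))"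
    unfolding K_def by (rule window_integral_empty_prob_pos[OF P W F])
  ultimately show ?thesis
    unfolding J_window_def K_def[symmetric]
    using bnd by (blast intro: set_integral_quotient_bounds)
qed

theorem proposition2:
  fixes M :: "'w measure"
    and X :: "'w \<Rightarrow> 'a::euclidean_space set"
    and P :: "'a set measure"
    and W :: "'a set"
  assumes "stationary_point_process M X"
    and "P = distribution M X"
    and "0 < intensity P" and "intensity P < \<infinity>"
    and "compact W" and "interior W \<noteq> {}"
  shows "(J_ordered P \<longrightarrow>
            (\<forall>r\<ge>0. F_fun P r < 1 \<longrightarrow> 1 \<le> J_window P W r \<and> J_window P W r \<le> J_fun P r)) \<and>
         (J_clustered P \<longrightarrow>
            (\<forall>r\<ge>0. F_fun P r < 1 \<longrightarrow> 1 \<ge> J_window P W r \<and> J_window P W r \<ge> J_fun P r))"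
proof -
  have M: "prob_space M" "X \<in> measurable M config_space"
    using assms(1) by (simp_all add: stationary_point_process_def point_process_def)
  have P: "finite_measure P" "sets P = sets config_space"
    unfolding assms(2) distribution_def
    using M by (auto intro: prob_space.finite_measure prob_space.prob_space_distr)
  have F0: "FF P {0} = 0"
    unfolding FF_def using assms(1,2,4) by (rule hitting_prob_origin_stationary)
  then have J0: "JJ P {0} = 1"
    by (simp add: JJ_def GG_def hitting_prob_origin_reduced_palm)
  have dom0: "{0} \<in> J_domain P" using F0 by (simp add: J_domain_def)
  have domr: "cball 0 r \<in> J_domain P" if "0 \<le> r" "F_fun P r < 1" for r
    using that by (simp add: J_domain_def F_fun_def)
  have Jr: "JJ P (cball 0 r) = J_fun P r" for r
    by (simp add: JJ_def J_fun_def F_fun_def G_fun_def)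
  have zero: "{0} \<subseteq> K" if "K \<in> J_domain P" for K using that by (simp add: J_domain_def)
  show ?thesis
  proof (intro conjI[of "_ \<longrightarrow> _"] impI allI)
    fix r :: real
    assume "J_ordered P" and r: "0 \<le> r" "F_fun P r < 1"
    then have "1 \<le> JJ P K \<and> JJ P K \<le> J_fun P r" if "K \<in> J_domain P" "K \<subseteq> cball 0 r" for K
      using that dom0 domr[OF r] zero[of K] unfolding J_ordered_def by (metis J0 Jr)
    then show "1 \<le> J_window P W r \<and> J_window P W r \<le> J_fun P r"
      using P assms(3-6) r by (intro J_window_bounds) auto
  next
    fix r :: real
    assume "J_clustered P" and r: "0 \<le> r" "F_fun P r < 1"
    then have "J_fun P r \<le> JJ P K \<and> JJ P K \<le> 1" if "K \<in> J_domain P" "K \<subseteq> cball 0 r" for K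
      using that dom0 domr[OF r] zero[of K] unfolding J_clustered_def by (metis J0 Jr)
    then have "J_fun P r \<le> J_window P W r \<and> J_window P W r \<le> 1"
      using P assms(3-6) r by (intro J_window_bounds) auto
    then show "1 \<ge> J_window P W r \<and> J_window P W r \<ge> J_fun P r" by simp
  qed
qed

end
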